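(* For $u\in\hat C^\infty(\mathbb{S}^1)$ let $\omega=\mathcal{H}\partial_x u$. Neither De Gregorio's vorticity model equation $$\omega_t+u\,\omega_x+\omega\,\mathcal{H}\omega=0$$ nor the quasi-geostrophic model equation $$\omega_t+u\,\omega_x=\omega\,\mathcal{H}\omega$$ can be realized as an Euler equation for any regular inertia operator $A\in\mathcal{L}^{sym}_{is}(\hat C^\infty(\mathbb{S}^1))$ of Fourier type. That is, for each of the two equations there is no such $A$ for which the equation, written as an evolution equation for $u\in\hat C^\infty(\mathbb{S}^1)$, coincides with $$u_t=-A^{-1}\big[2(Au)u_x+u(Au)_x\big].$$
   Context: $\mathbb{S}^1=\mathbb{R}/\mathbb{Z}$. $\hat C^\infty(\mathbb{S}^1)$ is the space of smooth real functions $u$ on $\mathbb{S}^1$ with $\int_{\mathbb{S}^1}u\,dx=0$. $\mathcal{H}$ is the Hilbert transform on $\mathbb{S}^1$, the Fourier multiplication operator with symbol $-i\,\mathrm{sign}(k)$ (and $0$ at $k=0$). Hence $\mathcal{H}\mathcal{H}\partial_x u=-u_x$, and $\mathcal{H}\partial_x$ is the Fourier multiplication operator with symbol a positive constant times $|k|$; it is an isomorphism of $\hat C^\infty(\mathbb{S}^1)$, and it is $(-\Delta)^{1/2}$ in the normalization where the derivative acts on the $k$-th Fourier mode as $ik$. $\mathcal{L}^{sym}_{is}(\hat C^\infty(\mathbb{S}^1))$ is the set of continuous linear isomorphisms of $\hat C^\infty(\mathbb{S}^1)$ onto itself that are symmetric with respect to the $L_2(\mathbb{S}^1)$ inner product (regular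 inertia operators). Such an $A$ is of Fourier type if it is a Fourier multiplication operator, i.e. (after complex-linear extension) $A e^{2\pi ikx}=\beta_k e^{2\pi ikx}$ for all $k\in\mathbb{Z}\setminus\{0\}$. The space $\hat C^\infty(\mathbb{S}^1)$ represents the Lie algebra of $\mathrm{Diff}^\infty_0(\mathbb{S}^1)=\{\varphi\in\mathrm{Diff}^\infty(\mathbb{S}^1):\varphi(x_0)=x_0\}$ ($x_0$ fixed), which is identified with the group $\mathrm{Diff}^\infty(\mathbb{S}^1)$ of smooth orientation-preserving diffeomorphisms of the circle modulo rotations. The Euler equation with respect to the right-invariant metric $\rho_A$ induced by $A$ (given at the identity by $\int (Au)v\,dx$) is $u_t=-A^{-1}[2(Au)u_x+u(Au)_x]$. An equation for $\omega$ as in the claim is converted into an evolution equation for $u$ by applying $(\mathcal{H}\partial_x)^{-1}$; it "coincides" with the Euler equation if the two right-hand sides agree for all $u\in\hat C^\infty(\mathbb{S}^1)$. *)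

theory Defs
  imports "HOL-Analysis.Analysis"
begin

(* Functions on the circle R/Z are represented as 1-periodic functions on R. *)

definition smooth :: "(real \<Rightarrow> real) \<Rightarrow> bool" where
  "smooth u \<longleftrightarrow> (\<forall>n x. (deriv ^^ n) u differentiable (at x))"

definition Chat :: "(real \<Rightarrow> real) set" where
  "Chat = {u. smooth u \<and> (\<forall>x. u (x + 1) = u x) \<and> integral {0..1} u = 0}"

(* The usual Frechet topology, generated by the balls of the seminorms sup |u^(n)|.
   By periodicity and continuity the supremum is attained, so the pointwise strict bound
   below is the same as sup |v^(n) - u^(n)| < e. *)
definition Chat_topology :: "(real \<Rightarrow> real) topology" where
  "Chat_topology = topology_generated_by
     {{v \<in> Chat. \<forall>x. \<bar>(deriv ^^ n) v x - (deriv ^^ n) u x\<bar> < e} | n u e. u \<in> Chat \<and> e > 0}"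

definition fourier_mode :: "int \<Rightarrow> real \<Rightarrow> complex" where
  "fourier_mode k x = cis (2 * pi * of_int k * x)"

definition fourier_coeff :: "(real \<Rightarrow> real) \<Rightarrow> int \<Rightarrow> complex" where
  "fourier_coeff u k = integral {0..1} (\<lambda>x. of_real (u x) * fourier_mode (- k) x)"

(* Intended for symbols with m (-k) = cnj (m k), which send real functions to real functions;
   the sum is then real and Re is only a coercion. For smooth u and bounded m the sum
   converges absolutely. *)
definition fourier_multiplier :: "(int \<Rightarrow> complex) \<Rightarrow> (real \<Rightarrow> real) \<Rightarrow> real \<Rightarrow> real" where
  "fourier_multiplier m u x = Re (\<Sum>\<^sub>\<infinity>k. m k * fourier_coeff u k * fourier_mode k x)"

definition hilbert :: "(real \<Rightarrow> real) \<Rightarrow> real \<Rightarrow> real" where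
  "hilbert = fourier_multiplier (\<lambda>k. - \<i> * of_int (sgn k))"

definition hilbert_deriv :: "(real \<Rightarrow> real) \<Rightarrow> real \<Rightarrow> real" where
  "hilbert_deriv u = hilbert (deriv u)"

(* Operators on Chat are total HOL functions whose values outside Chat are irrelevant. *)
definition regular_inertia_operator :: "((real \<Rightarrow> real) \<Rightarrow> real \<Rightarrow> real) \<Rightarrow> bool" where
  "regular_inertia_operator A \<longleftrightarrow>
     (\<forall>u\<in>Chat. \<forall>v\<in>Chat. A (\<lambda>x. u x + v x) = (\<lambda>x. A u x + A v x)) \<and>
     (\<forall>c. \<forall>u\<in>Chat. A (\<lambda>x. c * u x) = (\<lambda>x. c * A u x)) \<and>
     homeomorphic_map Chat_topology Chat_topology A \<and>
     (\<forall>u\<in>Chat. \<forall>v\<in>Chat.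
        integral {0..1} (\<lambda>x. A u x * v x) = integral {0..1} (\<lambda>x. u x * A v x))"

definition complex_extension ::
    "((real \<Rightarrow> real) \<Rightarrow> real \<Rightarrow> real) \<Rightarrow> (real \<Rightarrow> complex) \<Rightarrow> real \<Rightarrow> complex" where
  "complex_extension A f x = Complex (A (\<lambda>y. Re (f y)) x) (A (\<lambda>y. Im (f y)) x)"

definition fourier_type :: "((real \<Rightarrow> real) \<Rightarrow> real \<Rightarrow> real) \<Rightarrow> bool" where
  "fourier_type A \<longleftrightarrow> (\<exists>\<beta> :: int \<Rightarrow> complex. \<forall>k. k \<noteq> 0 \<longrightarrow>
     complex_extension A (fourier_mode k) = (\<lambda>x. \<beta> k * fourier_mode k x))"

(* Right-hand side of u_t = - A^{-1} [2 (A u) u_x + u (A u)_x]. *)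
definition euler_rhs :: "((real \<Rightarrow> real) \<Rightarrow> real \<Rightarrow> real) \<Rightarrow> (real \<Rightarrow> real) \<Rightarrow> real \<Rightarrow> real" where
  "euler_rhs A u =
     (\<lambda>x. - inv_into Chat A (\<lambda>y. 2 * A u y * deriv u y + u y * deriv (A u) y) x)"

(* Right-hand side F of w_t = - u w_x - w (H w), where w = H u_x. *)
definition de_gregorio_vorticity_rhs :: "(real \<Rightarrow> real) \<Rightarrow> real \<Rightarrow> real" where
  "de_gregorio_vorticity_rhs u =
     (let \<omega> = hilbert_deriv u in (\<lambda>x. - u x * deriv \<omega> x - \<omega> x * hilbert \<omega> x))"

(* Right-hand side F of w_t = - u w_x + w (H w), where w = H u_x. *)
definition quasi_geostrophic_vorticity_rhs :: "(real \<Rightarrow> real) \<Rightarrow> real \<Rightarrow> real" where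
  "quasi_geostrophic_vorticity_rhs u =
     (let \<omega> = hilbert_deriv u in (\<lambda>x. - u x * deriv \<omega> x + \<omega> x * hilbert \<omega> x))"

(* Turns an equation w_t = F u for w = H u_x into the evolution equation
   u_t = velocity_rhs F u; H d/dx is an isomorphism of Chat. *)
definition velocity_rhs ::
    "((real \<Rightarrow> real) \<Rightarrow> real \<Rightarrow> real) \<Rightarrow> (real \<Rightarrow> real) \<Rightarrow> real \<Rightarrow> real" where
  "velocity_rhs F u = inv_into Chat hilbert_deriv (F u)"

definition realizes_as_euler ::
    "((real \<Rightarrow> real) \<Rightarrow> real \<Rightarrow> real) \<Rightarrow> ((real \<Rightarrow> real) \<Rightarrow> real \<Rightarrow> real) \<Rightarrow> bool" where
  "realizes_as_euler A F \<longleftrightarrow> (\<forall>u\<in>Chat. velocity_rhs F u = euler_rhs A u)"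

end

theory Submission
  imports Defs
begin

text \<open>
  A Fourier type inertia operator acts on \<open>e\<^sub>k\<close> by a real factor \<open>b\<^sub>k = b\<^sub>-\<^sub>k \<noteq> 0\<close>, so on
  trigonometric polynomials the claimed coincidence becomes a family of relations between the
  \<open>b\<^sub>k\<close>. Since \<open>H \<omega> = - u\<^sub>x\<close>, the two models read \<open>\<omega>\<^sub>t = - u \<omega>\<^sub>x \<plusminus> u\<^sub>x \<omega>\<close>. For
  \<open>u = cos (2\<pi>x)\<close> the De Gregorio right-hand side vanishes, whereas the Euler right-hand side is a
  nonzero multiple of \<open>b\<^sub>1 sin (4\<pi>x)\<close>. For \<open>u = cos (2\<pi>x) + cos (4\<pi>x) + cos (6\<pi>x)\<close> the first
  three sine coefficients of the quasi-geostrophic equation give \<open>5b\<^sub>1 = 4b\<^sub>2 - b\<^sub>3\<close>,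
  \<open>5b\<^sub>2 = 8b\<^sub>1 + b\<^sub>3\<close> and \<open>3b\<^sub>3 = 5b\<^sub>1 + 4b\<^sub>2\<close>, which force \<open>b\<^sub>1 = 0\<close>.
\<close>

section \<open>Fourier modes: products, derivative, integral over a period\<close>

lemma fourier_mode_mult: "fourier_mode j x * fourier_mode k x = fourier_mode (j + k) x"
  by (simp add: fourier_mode_def cis_mult algebra_simps)

lemma fourier_mode_uminus: "fourier_mode (- k) x = cnj (fourier_mode k x)"
  by (simp add: fourier_mode_def cis_cnj)

lemma fourier_mode_add_one: "fourier_mode k (x + 1) = fourier_mode k x"
proof -
  have "cis (2 * pi * of_int k) = 1"
    using cis_multiple_2pi[of "of_int k"] by (simp add: mult.commute)
  then show ?thesis
    by (simp add: fourier_mode_def distrib_left flip: cis_mult)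
qed

lemma fourier_mode_has_vector_derivative:
  "(fourier_mode k has_vector_derivative (2 * pi * \<i> * of_int k * fourier_mode k x)) (at x within S)"
  unfolding fourier_mode_def has_vector_derivative_def
  by (auto intro!: derivative_eq_intros simp: fun_eq_iff complex_eq_iff algebra_simps)

lemma has_integral_fourier_mode:
  "(fourier_mode k has_integral (if k = 0 then 1 else 0)) {0..1}"
proof (cases "k = 0")
  case True
  then have "fourier_mode k = (\<lambda>x. 1)"
    by (simp add: fourier_mode_def fun_eq_iff)
  then show ?thesis
    using True has_integral_const_real[of "1::complex" 0 1] by simp
next
  case False
  let ?c = "2 * pi * \<i> * of_int k :: complex"
  have "((\<lambda>x. fourier_mode k x / ?c) has_vector_derivative fourier_mode k x) (at x within {0..1})" for x
    using has_vector_derivative_divide[OF fourier_mode_has_vector_derivative, of k ?c x "{0..1}"] False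
    by simp
  then have "(fourier_mode k has_integral fourier_mode k 1 / ?c - fourier_mode k 0 / ?c) {0..1}"
    by (intro fundamental_theorem_of_calculus) auto
  then show ?thesis
    using False fourier_mode_add_one[of k 0] by simp
qed

section \<open>Real trigonometric polynomials\<close>

text \<open>Taking the real part makes the function real for arbitrary complex coefficients, with no
  symmetry condition between k and -k. Real coefficients give cosine sums; coefficients -i p with p
  real give sine sums with amplitudes p.\<close>

definition trig_poly :: "int set \<Rightarrow> (int \<Rightarrow> complex) \<Rightarrow> real \<Rightarrow> real" where
  "trig_poly K z x = Re (\<Sum>k\<in>K. z k * fourier_mode k x)"

lemma trig_poly_eq_cos_sin:
  "trig_poly K z x = (\<Sum>k\<in>K. Re (z k) * cos (2 * pi * of_int k * x) - Im (z k) * sin (2 * pi * of_int k * x))"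
  by (simp add: trig_poly_def fourier_mode_def)

lemma trig_poly_cong: "(\<And>k. k \<in> K \<Longrightarrow> z k = w k) \<Longrightarrow> trig_poly K z = trig_poly K w"
  by (simp add: trig_poly_def fun_eq_iff cong: sum.cong)

lemma of_real_trig_poly:
  "complex_of_real (trig_poly K z x) =
     (\<Sum>k\<in>K. z k / 2 * fourier_mode k x + cnj (z k) / 2 * fourier_mode (- k) x)"
proof -
  have "z k / 2 * fourier_mode k x + cnj (z k) / 2 * fourier_mode (- k) x =
        complex_of_real (Re (z k * fourier_mode k x))" for k
    by (simp add: fourier_mode_uminus complex_eq_iff field_simps)
  then show ?thesis
    by (simp add: trig_poly_def)
qed

lemma trig_poly_has_real_derivative:
  "(trig_poly K z has_real_derivative trig_poly K (\<lambda>k. 2 * pi * \<i> * of_int k * z k) x) (at x)"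
  unfolding trig_poly_eq_cos_sin
  by (auto intro!: derivative_eq_intros sum.cong simp: algebra_simps)

lemma deriv_trig_poly: "deriv (trig_poly K z) = trig_poly K (\<lambda>k. 2 * pi * \<i> * of_int k * z k)"
  using DERIV_imp_deriv[OF trig_poly_has_real_derivative] by blast

lemma smooth_trig_poly: "smooth (trig_poly K z)"
proof -
  have "\<exists>w. (deriv ^^ n) (trig_poly K z) = trig_poly K w" for n
    by (induction n) (auto simp: deriv_trig_poly)
  then show ?thesis
    unfolding smooth_def
    by (metis trig_poly_has_real_derivative real_differentiable_def)
qed

text \<open>Orthogonality of the modes selects frequency j. Two contributions arise because the real
  part spreads the term at k over the frequencies k and -k.\<close>

lemma fourier_coeff_trig_poly:
  assumes "finite K"
  shows "fourier_coeff (trig_poly K z) j =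
           (if j \<in> K then z j / 2 else 0) + (if - j \<in> K then cnj (z (- j)) / 2 else 0)"
proof -
  have "((\<lambda>x. \<Sum>k\<in>K. z k / 2 * fourier_mode (k - j) x + cnj (z k) / 2 * fourier_mode (- k - j) x)
      has_integral (\<Sum>k\<in>K. z k / 2 * (if k - j = 0 then 1 else 0) +
                            cnj (z k) / 2 * (if - k - j = 0 then 1 else 0))) {0..1}"
    by (intro has_integral_sum has_integral_add has_integral_mult_right has_integral_fourier_mode assms)
  moreover have "complex_of_real (trig_poly K z x) * fourier_mode (- j) x =
      (\<Sum>k\<in>K. z k / 2 * fourier_mode (k - j) x + cnj (z k) / 2 * fourier_mode (- k - j) x)" for x
    by (simp add: of_real_trig_poly sum_distrib_right distrib_right mult.assoc fourier_mode_mult)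
  moreover have "(\<Sum>k\<in>K. z k / 2 * (if k - j = 0 then 1 else 0)) = (if j \<in> K then z j / 2 else 0)"
    using assms by (simp add: if_distrib cong: if_cong)
  moreover have "(\<Sum>k\<in>K. cnj (z k) / 2 * (if - k - j = 0 then 1 else 0)) =
      (if - j \<in> K then cnj (z (- j)) / 2 else 0)"
  proof -
    have "- k - j = 0 \<longleftrightarrow> k = - j" for k by auto
    then show ?thesis
      using assms by (simp add: if_distrib cong: if_cong)
  qed
  ultimately show ?thesis
    unfolding fourier_coeff_def sum.distrib by (simp add: integral_unique)
qed

lemma trig_poly_in_Chat:
  assumes "finite K" "0 \<notin> K"
  shows "trig_poly K z \<in> Chat"
proof -
  have "(trig_poly K z has_integral 0) {0..1}"
  proof -
    have "((\<lambda>x. \<Sum>k\<in>K. z k * fourier_mode k x) has_integral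
            (\<Sum>k\<in>K. z k * (if k = 0 then 1 else 0))) {0..1}"
      by (intro has_integral_sum has_integral_mult_right has_integral_fourier_mode assms)
    moreover have "(\<Sum>k\<in>K. z k * (if k = 0 then 1 else 0)) = 0"
      using assms by (auto intro!: sum.neutral)
    ultimately have "((\<lambda>x. \<Sum>k\<in>K. z k * fourier_mode k x) has_integral 0) {0..1}"
      by simp
    from has_integral_Re[OF this] show ?thesis
      unfolding trig_poly_def[abs_def] by simp
  qed
  then have "integral {0..1} (trig_poly K z) = 0"
    by (rule integral_unique)
  moreover have "trig_poly K z (x + 1) = trig_poly K z x" for x
    by (simp add: trig_poly_def fourier_mode_add_one)
  ultimately show ?thesis
    by (simp add: Chat_def smooth_trig_poly)
qed

text \<open>With only positive frequencies the conjugate halves sit at negative ones, so the Fourier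
  coefficient at k is exactly \<open>z k / 2\<close>. A frequency 0 would lose the imaginary part of
  its coefficient, and a pair k, -k would mix two coefficients.\<close>

lemma trig_poly_eqD:
  assumes "trig_poly K z = trig_poly K w" "finite K" "\<And>k. k \<in> K \<Longrightarrow> 0 < k" "k \<in> K"
  shows "z k = w k"
proof -
  have "- k \<notin> K"
    using assms(3)[of k] assms(3)[of "- k"] assms(4) by fastforce
  then show ?thesis
    using fourier_coeff_trig_poly[OF assms(2), of z k] fourier_coeff_trig_poly[OF assms(2), of w k]
      assms(1,4) by simp
qed

text \<open>Fourier coefficients vanish off \<open>K\<close> and its negative, so the infinite sum
  is finite. The condition on \<open>m\<close> makes the terms at k and -k conjugate, and their sum
  is therefore real.\<close>

lemma fourier_multiplier_trig_poly:
  assumes K: "finite K" "\<And>k. k \<in> K \<Longrightarrow> 0 < k"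
    and m: "\<And>k. m (- k) = cnj (m k)"
  shows "fourier_multiplier m (trig_poly K z) = trig_poly K (\<lambda>k. m k * z k)"
proof
  fix x
  let ?t = "\<lambda>k. m k * fourier_coeff (trig_poly K z) k * fourier_mode k x"
  have neg: "- k \<notin> K" if "k \<in> K" for k
    using K(2)[of k] K(2)[of "- k"] that by fastforce
  have "(\<Sum>\<^sub>\<infinity>k. ?t k) = (\<Sum>\<^sub>\<infinity>k\<in>K \<union> uminus ` K. ?t k)"
    proof (rule infsum_cong_neutral)
    show "?t k = 0" if "k \<in> UNIV - (K \<union> uminus ` K)" for k
    proof -
      from that have "k \<notin> K" "- k \<notin> K"
        using image_eqI[of k uminus "- k" K] by auto
      then show ?thesis
        by (simp add: fourier_coeff_trig_poly[OF K(1)])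
    qed
  qed auto
  also have "\<dots> = (\<Sum>k\<in>K. ?t k) + (\<Sum>k\<in>uminus ` K. ?t k)"
    using K(1) neg by (subst infsum_finite, simp, subst sum.union_disjoint) auto
  also have "(\<Sum>k\<in>uminus ` K. ?t k) = (\<Sum>k\<in>K. ?t (- k))"
    by (subst sum.reindex) (auto simp: inj_on_def)
  also have "(\<Sum>k\<in>K. ?t k) + (\<Sum>k\<in>K. ?t (- k)) =
      (\<Sum>k\<in>K. m k * z k / 2 * fourier_mode k x + cnj (m k * z k) / 2 * fourier_mode (- k) x)"
    unfolding sum.distrib[symmetric]
    by (rule sum.cong) (auto simp: fourier_coeff_trig_poly[OF K(1)] neg m)
  also have "\<dots> = complex_of_real (trig_poly K (\<lambda>k. m k * z k) x)"
    by (simp add: of_real_trig_poly)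
  finally show "fourier_multiplier m (trig_poly K z) x = trig_poly K (\<lambda>k. m k * z k) x"
    by (simp add: fourier_multiplier_def)
qed

lemma hilbert_trig_poly:
  assumes "finite K" "\<And>k. k \<in> K \<Longrightarrow> 0 < k"
  shows "hilbert (trig_poly K z) = trig_poly K (\<lambda>k. - \<i> * z k)"
  unfolding hilbert_def
  by (subst fourier_multiplier_trig_poly) (use assms in \<open>auto simp: sgn_minus intro!: trig_poly_cong\<close>)

text \<open>The symbols multiply to (-i)(2 pi i k) = 2 pi k for k > 0.\<close>

lemma hilbert_deriv_trig_poly:
  fixes z :: "int \<Rightarrow> complex"
  assumes "finite K" "\<And>k. k \<in> K \<Longrightarrow> 0 < k"
  shows "hilbert_deriv (trig_poly K z) = trig_poly K (\<lambda>k. 2 * pi * of_int k * z k)"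
  unfolding hilbert_deriv_def deriv_trig_poly
  by (subst hilbert_trig_poly) (use assms in \<open>auto intro!: trig_poly_cong simp: algebra_simps\<close>)

section \<open>Inertia operators of Fourier type\<close>

text \<open>Lets bijectivity of \<open>A\<close> on \<open>Chat\<close> be read off from
  \<open>homeomorphic_map\<close>.\<close>

lemma topspace_Chat_topology: "topspace Chat_topology = Chat"
proof -
  have "u \<in> topspace Chat_topology" if "u \<in> Chat" for u
    unfolding Chat_topology_def topology_generated_by_topspace
  proof (rule UnionI)
    \<comment> \<open>Each u lies in the ball of order 0 and radius 1 around itself.\<close>
    show "{v \<in> Chat. \<forall>x. \<bar>(deriv ^^ 0) v x - (deriv ^^ 0) u x\<bar> < 1} \<in>
      {{v \<in> Chat. \<forall>x. \<bar>(deriv ^^ n) v x - (deriv ^^ n) u x\<bar> < e} | n u e. u \<in> Chat \<and> e > 0}"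
      using that zero_less_one by blast
  qed (use that in simp)
  moreover have "topspace Chat_topology \<subseteq> Chat"
    unfolding Chat_topology_def topology_generated_by_topspace by blast
  ultimately show ?thesis
    by blast
qed

lemma regular_inertia_operator_bij_betw:
  "regular_inertia_operator A \<Longrightarrow> bij_betw A Chat Chat"
  by (simp add: regular_inertia_operator_def bij_betw_def homeomorphic_eq_everything_map
      topspace_Chat_topology)

lemma regular_inertia_operator_linear:
  assumes "regular_inertia_operator A" "u \<in> Chat" "v \<in> Chat"
  shows "A (\<lambda>x. u x + v x) = (\<lambda>x. A u x + A v x)" and "A (\<lambda>x. c * u x) = (\<lambda>x. c * A u x)"
  using assms by (auto simp: regular_inertia_operator_def)

text \<open>The eigenvalue is a priori complex. Symmetry, tested on the cosine and sine of frequency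
  k, kills its imaginary part, and injectivity excludes 0. Linearity extends the result from these
  two functions to their span.\<close>

lemma fourier_type_real_eigenvalue:
  assumes A: "regular_inertia_operator A" "fourier_type A" and "k \<noteq> 0"
  shows "\<exists>b::real. b \<noteq> (0::real) \<and> (\<forall>z :: int \<Rightarrow> complex. A (trig_poly {k} z) = trig_poly {k} (\<lambda>j. b * z j))"
proof -
  define C S where "C = (\<lambda>x. Re (fourier_mode k x))" and "S = (\<lambda>x. Im (fourier_mode k x))"
  have CS_poly: "C = trig_poly {k} (\<lambda>_. 1)" "S = trig_poly {k} (\<lambda>_. - \<i>)"
    by (auto simp: trig_poly_def C_def S_def)
  then have CS: "C \<in> Chat" "S \<in> Chat"
    using \<open>k \<noteq> 0\<close> by (auto intro!: trig_poly_in_Chat)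
  obtain \<beta> where \<beta>: "complex_extension A (fourier_mode k) = (\<lambda>x. \<beta> * fourier_mode k x)"
    using A(2) \<open>k \<noteq> 0\<close> unfolding fourier_type_def by blast
  have "Complex (A C x) (A S x) = \<beta> * fourier_mode k x" for x
    using fun_cong[OF \<beta>, of x] by (simp add: complex_extension_def C_def S_def)
  then have AC: "A C = (\<lambda>x. Re \<beta> * C x - Im \<beta> * S x)" and AS: "A S = (\<lambda>x. Re \<beta> * S x + Im \<beta> * C x)"
    by (auto simp: fun_eq_iff complex_eq_iff C_def S_def)
  have sq: "C x * C x + S x * S x = 1" for x
    by (simp add: C_def S_def fourier_mode_def flip: power2_eq_square)
  have cont: "continuous_on {0..1} C" "continuous_on {0..1} S"
    unfolding C_def S_def fourier_mode_def by (auto intro!: continuous_intros)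
  \<comment> \<open>Symmetry makes the left side 0, while the integrand is -Im \<beta> times C^2 +
    S^2 = 1.\<close>
  have "integral {0..1} (\<lambda>x. A C x * S x) - integral {0..1} (\<lambda>x. C x * A S x) =
      integral {0..1} (\<lambda>x. A C x * S x - C x * A S x)"
    unfolding AC AS
    by (intro integral_diff[symmetric] integrable_continuous_interval continuous_intros cont)
  also have "(\<lambda>x. A C x * S x - C x * A S x) = (\<lambda>x. - Im \<beta> * (C x * C x + S x * S x))"
    unfolding AC AS by (simp add: fun_eq_iff algebra_simps)
  also have "integral {0..1} \<dots> = - Im \<beta>"
    by (simp add: sq)
  finally have "Im \<beta> = 0"
    using A(1) CS by (simp add: regular_inertia_operator_def)
  then have eig: "A C = (\<lambda>x. Re \<beta> * C x)" "A S = (\<lambda>x. Re \<beta> * S x)"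
    by (auto simp: AC AS)
  have "Re \<beta> \<noteq> 0"
  proof
    assume "Re \<beta> = 0"
    \<comment> \<open>A zero eigenvalue would send both the zero function and the cosine to zero,
      although the cosine is 1 at 0.\<close>
    then have "A (\<lambda>x. 0 * C x) = A C"
      unfolding regular_inertia_operator_linear(2)[OF A(1) CS] by (simp add: eig)
    moreover have "(\<lambda>x. 0 * C x) \<in> Chat"
      using trig_poly_in_Chat[of "{}"] by (simp add: trig_poly_def[abs_def])
    ultimately have "(\<lambda>x. 0 * C x) = C"
      using regular_inertia_operator_bij_betw[OF A(1)] CS by (metis bij_betw_def inj_onD)
    from fun_cong[OF this, of 0] show False
      by (simp add: C_def fourier_mode_def)
  qed
  moreover have "A (trig_poly {k} z) = trig_poly {k} (\<lambda>j. Re \<beta> * z j)" for z :: "int \<Rightarrow> complex"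
  proof -
    have scaled: "(\<lambda>x. c * C x) \<in> Chat" "(\<lambda>x. c * S x) \<in> Chat" for c
    proof -
      have "(\<lambda>x. c * C x) = trig_poly {k} (\<lambda>_. c)" "(\<lambda>x. c * S x) = trig_poly {k} (\<lambda>_. - \<i> * c)"
        by (auto simp: trig_poly_def C_def S_def)
      then show "(\<lambda>x. c * C x) \<in> Chat" "(\<lambda>x. c * S x) \<in> Chat"
        using \<open>k \<noteq> 0\<close> by (auto intro!: trig_poly_in_Chat)
    qed
    have "trig_poly {k} z = (\<lambda>x. Re (z k) * C x + (- Im (z k)) * S x)"
      by (auto simp: trig_poly_def C_def S_def)
    then have "A (trig_poly {k} z) = (\<lambda>x. Re (z k) * A C x + (- Im (z k)) * A S x)"
      by (simp only: regular_inertia_operator_linear(1)[OF A(1) scaled]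
          regular_inertia_operator_linear(2)[OF A(1) CS] regular_inertia_operator_linear(2)[OF A(1) CS(2,1)])
    also have "\<dots> = trig_poly {k} (\<lambda>j. Re \<beta> * z j)"
      unfolding eig by (simp add: trig_poly_def C_def S_def fun_eq_iff algebra_simps)
    finally show ?thesis .
  qed
  ultimately show ?thesis by blast
qed

text \<open>One sequence \<open>b\<close> is chosen before \<open>K\<close> and \<open>z\<close>;
  additivity then assembles the single frequencies.\<close>

lemma fourier_type_trig_poly:
  assumes "regular_inertia_operator A" "fourier_type A"
  obtains b :: "int \<Rightarrow> real" where "\<And>k. k \<noteq> 0 \<Longrightarrow> b k \<noteq> 0"
    and "\<And>K (z :: int \<Rightarrow> complex). finite K \<Longrightarrow> 0 \<notin> K \<Longrightarrow> A (trig_poly K z) = trig_poly K (\<lambda>k. b k * z k)"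
proof -
  obtain b :: "int \<Rightarrow> real" where b: "\<And>k. k \<noteq> 0 \<Longrightarrow> b k \<noteq> 0"
    "\<And>k (z :: int \<Rightarrow> complex). k \<noteq> 0 \<Longrightarrow> A (trig_poly {k} z) = trig_poly {k} (\<lambda>j. b k * z j)"
    using fourier_type_real_eigenvalue[OF assms] by metis
  have "A (trig_poly K z) = trig_poly K (\<lambda>k. b k * z k)" if "finite K" "0 \<notin> K" for K and z :: "int \<Rightarrow> complex"
    using that
  proof (induction K rule: finite_induct)
    case empty
    \<comment> \<open>The empty sum is the zero function, fixed by \<open>A\<close> through
      homogeneity with factor 0.\<close>
    have "(\<lambda>x. 0) = trig_poly {} z"
      by (simp add: trig_poly_def fun_eq_iff)
    then show ?case
      using regular_inertia_operator_linear(2)[OF assms(1), of "trig_poly {} z" "trig_poly {} z" 0]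
        trig_poly_in_Chat[of "{}" z] by (simp add: trig_poly_def fun_eq_iff)
  next
    case (insert k K)
    have split: "trig_poly (insert k K) w = (\<lambda>x. trig_poly {k} w x + trig_poly K w x)" for w
      using insert by (simp add: trig_poly_def fun_eq_iff)
    have "A (trig_poly (insert k K) z) = (\<lambda>x. A (trig_poly {k} z) x + A (trig_poly K z) x)"
      unfolding split
      by (rule regular_inertia_operator_linear(1)[OF assms(1)]) (use insert in \<open>auto intro!: trig_poly_in_Chat\<close>)
    also have "\<dots> = trig_poly (insert k K) (\<lambda>k. b k * z k)"
    proof -
      have "A (trig_poly K z) = trig_poly K (\<lambda>k. b k * z k)"
        "A (trig_poly {k} z) = trig_poly {k} (\<lambda>k. b k * z k)"
        using insert b(2)[of k z] by (auto intro!: trig_poly_cong)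
      then show ?thesis
        unfolding split by simp
    qed
    finally show ?case .
  qed
  with b(1) show ?thesis by (rule that)
qed

section \<open>Comparison of Fourier coefficients\<close>

text \<open>Inverting \<open>A\<close> divides the k-th coefficient by b_k, and
  \<open>hilbert_deriv\<close> multiplies it by 2 pi k. Applying \<open>hilbert_deriv\<close> to
  both evolution equations thus leaves f_k = -2 pi k g_k / b_k.\<close>

lemma realizes_as_euler_coeff:
  fixes b :: "int \<Rightarrow> real" and f g :: "int \<Rightarrow> complex"
  assumes A: "regular_inertia_operator A"
    and b: "\<And>k. k \<in> K \<Longrightarrow> b k \<noteq> 0" "\<And>z :: int \<Rightarrow> complex. A (trig_poly K z) = trig_poly K (\<lambda>k. b k * z k)"
    and K: "finite K" "\<And>k. k \<in> K \<Longrightarrow> 0 < k"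
    and F: "realizes_as_euler A F" "u \<in> Chat" "F u = trig_poly K f"
    and g: "(\<lambda>y. 2 * A u y * deriv u y + u y * deriv (A u) y) = trig_poly K g"
    and "k \<in> K"
  shows "f k * b k = - 2 * pi * of_int k * g k"
proof -
  have K0: "0 \<notin> K"
    using K(2) by force
  have "A (trig_poly K (\<lambda>k. g k / b k)) = trig_poly K g"
    unfolding b(2) using b(1) by (auto intro!: trig_poly_cong)
  then have "inv_into Chat A (trig_poly K g) = trig_poly K (\<lambda>k. g k / b k)"
    using regular_inertia_operator_bij_betw[OF A] trig_poly_in_Chat[OF K(1) K0]
    by (intro inv_into_f_eq) (auto simp: bij_betw_def)
  then have "euler_rhs A u = trig_poly K (\<lambda>k. - g k / b k)"
    by (simp add: euler_rhs_def g trig_poly_def fun_eq_iff sum_negf)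
  \<comment> \<open>\<open>inv_into\<close> returns a genuine preimage once one exists in
    \<open>Chat\<close>; dividing the coefficients of \<open>F u\<close> by 2 pi k exhibits
    one.\<close>
  moreover have "hilbert_deriv (velocity_rhs F u) = F u"
  proof -
    have "hilbert_deriv (trig_poly K (\<lambda>k. f k / (2 * pi * of_int k))) = F u"
      unfolding F(3)
      by (subst hilbert_deriv_trig_poly) (use K K0 in \<open>auto intro!: trig_poly_cong\<close>)
    then have "F u \<in> hilbert_deriv ` Chat"
      by (rule image_eqI[OF sym trig_poly_in_Chat[OF K(1) K0]])
    then show ?thesis
      unfolding velocity_rhs_def by (rule f_inv_into_f)
  qed
  ultimately have "trig_poly K (\<lambda>k. 2 * pi * of_int k * (- g k / b k)) = trig_poly K f"
    using F unfolding realizes_as_euler_def by (simp add: hilbert_deriv_trig_poly[OF K])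
  from trig_poly_eqD[OF this K \<open>k \<in> K\<close>] have "2 * pi * of_int k * (- g k / b k) = f k"
    by simp
  then show ?thesis
    using b(1)[OF \<open>k \<in> K\<close>] by (simp add: field_simps)
qed

text \<open>For an even test function every quadratic term of the equations is a sine sum times a
  cosine sum, so sin a cos b = (sin (a + b) + sin (a - b)) / 2 evaluates all of them.\<close>

lemma trig_poly_sin_times_cos:
  fixes p q :: "int \<Rightarrow> real"
  shows "trig_poly M (\<lambda>m. - \<i> * p m) x * trig_poly N (\<lambda>n. q n) x =
    (\<Sum>m\<in>M. \<Sum>n\<in>N. p m * q n / 2 * (Im (fourier_mode (m + n) x) + Im (fourier_mode (m - n) x)))"
proof -
  have "Im (fourier_mode m x) * Re (fourier_mode n x) =
      (Im (fourier_mode (m + n) x) + Im (fourier_mode (m - n) x)) / 2" for m n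
    using fourier_mode_mult[of m x n] fourier_mode_mult[of m x "- n"]
    by (simp add: complex_eq_iff fourier_mode_uminus)
  then have product: "p m * q n / 2 * (Im (fourier_mode (m + n) x) + Im (fourier_mode (m - n) x)) =
      (p m * Im (fourier_mode m x)) * (q n * Re (fourier_mode n x))" for m n
    by (simp add: field_simps)
  have "trig_poly M (\<lambda>m. - \<i> * p m) x * trig_poly N (\<lambda>n. q n) x =
      (\<Sum>m\<in>M. p m * Im (fourier_mode m x)) * (\<Sum>n\<in>N. q n * Re (fourier_mode n x))"
    by (simp add: trig_poly_def)
  then show ?thesis
    unfolding product sum_product .
qed

section \<open>Test functions for the two models\<close>

lemma not_realizes_de_gregorio:
  assumes A: "regular_inertia_operator A" "fourier_type A"
  shows "\<not> realizes_as_euler A de_gregorio_vorticity_rhs"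
proof
  assume real: "realizes_as_euler A de_gregorio_vorticity_rhs"
  obtain b :: "int \<Rightarrow> real" where b: "\<And>k. k \<noteq> 0 \<Longrightarrow> b k \<noteq> 0"
    "\<And>K (z :: int \<Rightarrow> complex). finite K \<Longrightarrow> 0 \<notin> K \<Longrightarrow> A (trig_poly K z) = trig_poly K (\<lambda>k. b k * z k)"
    using fourier_type_trig_poly[OF A] by blast
  define u where "u = trig_poly {1} (\<lambda>k. 1)"
  \<comment> \<open>The coefficient is written as a coerced real to match
    \<open>trig_poly_sin_times_cos\<close>.\<close>
  then have u_cos: "u = trig_poly {1} (\<lambda>k. complex_of_real 1)"
    by simp
  have deriv_u: "deriv u = trig_poly {1} (\<lambda>k. - \<i> * (- 2 * pi * k))"
    unfolding u_def deriv_trig_poly by (intro trig_poly_cong) simp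
  have Au: "A u = trig_poly {1} (\<lambda>k. b k)"
    unfolding u_def by (simp add: b(2))
  have deriv_Au: "deriv (A u) = trig_poly {1} (\<lambda>k. - \<i> * (- 2 * pi * k * b k))"
    unfolding Au deriv_trig_poly by (intro trig_poly_cong) simp
  have \<omega>: "hilbert_deriv u = trig_poly {1} (\<lambda>k. 2 * pi * k)"
    unfolding u_def by (subst hilbert_deriv_trig_poly) simp_all
  \<comment> \<open>Here \<omega> = 2 pi u and H \<omega> = -u_x, so the two terms cancel. The zero
    function is written over frequency 2, where the Euler side lives.\<close>
  have F: "de_gregorio_vorticity_rhs u = trig_poly {2} (\<lambda>k. 0)"
    unfolding de_gregorio_vorticity_rhs_def \<omega> Let_def deriv_trig_poly
    by (subst hilbert_trig_poly) (simp_all add: u_def trig_poly_def fun_eq_iff)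
  have "2 * A u y * deriv u y + u y * deriv (A u) y =
      trig_poly {2} (\<lambda>k. - \<i> * (- 3 * pi * b 1)) y" for y
  proof -
    have "2 * A u y * deriv u y + u y * deriv (A u) y = 2 * (deriv u y * A u y) + deriv (A u) y * u y"
      by simp
    also have "\<dots> = trig_poly {2} (\<lambda>k. - \<i> * (- 3 * pi * b 1)) y"
      \<comment> \<open>\<open>deriv_Au\<close> must come before \<open>Au\<close>, which would
        rewrite its left-hand side.\<close>
      unfolding deriv_Au unfolding Au deriv_u unfolding u_cos trig_poly_sin_times_cos
      by (simp add: trig_poly_def fourier_mode_def)
    finally show ?thesis .
  qed
  then have G: "(\<lambda>y. 2 * A u y * deriv u y + u y * deriv (A u) y) =
      trig_poly {2} (\<lambda>k. - \<i> * (- 3 * pi * b 1))"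
    by blast
  have "(0::complex) * b 2 = - 2 * pi * of_int 2 * (- \<i> * (- 3 * pi * b 1))"
    by (rule realizes_as_euler_coeff[OF A(1) _ _ _ _ real _ F G])
      (use b in \<open>auto simp: u_def intro!: trig_poly_in_Chat\<close>)
  then show False
    using b(1)[of 1] by simp
qed

lemma not_realizes_quasi_geostrophic:
  assumes A: "regular_inertia_operator A" "fourier_type A"
  shows "\<not> realizes_as_euler A quasi_geostrophic_vorticity_rhs"
proof
  assume real: "realizes_as_euler A quasi_geostrophic_vorticity_rhs"
  obtain b :: "int \<Rightarrow> real" where b: "\<And>k. k \<noteq> 0 \<Longrightarrow> b k \<noteq> 0"
    "\<And>K (z :: int \<Rightarrow> complex). finite K \<Longrightarrow> 0 \<notin> K \<Longrightarrow> A (trig_poly K z) = trig_poly K (\<lambda>k. b k * z k)"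
    using fourier_type_trig_poly[OF A] by blast
  \<comment> \<open>\<open>K\<close> holds all sums and nonzero absolute differences of frequencies
    in \<open>M\<close>. The equations at k = 1, 2, 3 form a closed linear system in b_1, b_2,
    b_3.\<close>
  define M K :: "int set" where "M = {1, 2, 3}" and "K = {1, 2, 3, 4, 5, 6}"
  have M: "finite M" "0 \<notin> M" "\<And>k. k \<in> M \<Longrightarrow> 0 < k"
    and K: "finite K" "0 \<notin> K" "\<And>k. k \<in> K \<Longrightarrow> 0 < k"
    by (auto simp: M_def K_def)
  define u where "u = trig_poly M (\<lambda>k. 1)"
  then have u_cos: "u = trig_poly M (\<lambda>k. complex_of_real 1)"
    by simp
  have deriv_u: "deriv u = trig_poly M (\<lambda>k. - \<i> * (- 2 * pi * k))"
    unfolding u_def deriv_trig_poly by (intro trig_poly_cong) simp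
  have Au: "A u = trig_poly M (\<lambda>k. b k)"
    unfolding u_def by (simp add: b(2) M)
  have deriv_Au: "deriv (A u) = trig_poly M (\<lambda>k. - \<i> * (- 2 * pi * k * b k))"
    unfolding Au deriv_trig_poly by (intro trig_poly_cong) simp
  have \<omega>: "hilbert_deriv u = trig_poly M (\<lambda>k. 2 * pi * k)"
    unfolding u_def by (subst hilbert_deriv_trig_poly) (simp_all add: M)
  have deriv_\<omega>: "deriv (hilbert_deriv u) = trig_poly M (\<lambda>k. - \<i> * (- (2 * pi * k)\<^sup>2))"
    unfolding \<omega> deriv_trig_poly by (intro trig_poly_cong) (simp add: power2_eq_square)
  have H\<omega>: "hilbert (hilbert_deriv u) = trig_poly M (\<lambda>k. - \<i> * (2 * pi * k))"
    unfolding \<omega> by (subst hilbert_trig_poly) (simp_all add: M)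
  \<comment> \<open>Sine coefficients in units of 4 pi^2: the pair (m, n) contributes m (m + n) / 2
    at the frequencies m + n and m - n.\<close>
  define f where "f = (\<lambda>k::int. if k = 1 then 4 else if k = 2 then 5 else if k = 3 then 9 / 2
      else if k = 4 then 12 else if k = 5 then 25 / 2 else (9::real))"
  \<comment> \<open>Sine coefficients in units of -pi: the pair (m, n) contributes m (2 b_n + b_m)
    at m + n and m - n.\<close>
  define g where "g = (\<lambda>k::int. if k = 1 then 3 * b 1 + 4 * b 2 - b 3 else if k = 2 then 8 * b 1 + b 3
      else if k = 3 then 5 * b 1 + 4 * b 2 else if k = 4 then 7 * b 1 + 6 * b 2 + 5 * b 3
      else if k = 5 then 8 * b 2 + 7 * b 3 else 9 * b 3)"
  \<comment> \<open>Folds negative differences m - n onto positive frequencies with a sign and drops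
    the diagonal m = n.\<close>
  have mode_neg: "Im (fourier_mode (- 1) y) = - Im (fourier_mode 1 y)"
    "Im (fourier_mode (- 2) y) = - Im (fourier_mode 2 y)" "Im (fourier_mode 0 y) = 0" for y
    by (simp_all add: fourier_mode_uminus fourier_mode_def)
  have "quasi_geostrophic_vorticity_rhs u y = trig_poly K (\<lambda>k. - \<i> * (4 * pi\<^sup>2 * f k)) y" for y
  proof -
    have "quasi_geostrophic_vorticity_rhs u y =
        - (deriv (hilbert_deriv u) y * u y) + hilbert (hilbert_deriv u) y * hilbert_deriv u y"
      by (simp add: quasi_geostrophic_vorticity_rhs_def Let_def mult.commute)
    also have "\<dots> = trig_poly K (\<lambda>k. - \<i> * (4 * pi\<^sup>2 * f k)) y"
      unfolding deriv_\<omega> H\<omega> unfolding \<omega> unfolding u_cos trig_poly_sin_times_cos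
      by (simp add: trig_poly_def M_def K_def f_def mode_neg power2_eq_square field_simps)
    finally show ?thesis .
  qed
  then have F: "quasi_geostrophic_vorticity_rhs u = trig_poly K (\<lambda>k. - \<i> * (4 * pi\<^sup>2 * f k))"
    by blast
  have "2 * A u y * deriv u y + u y * deriv (A u) y = trig_poly K (\<lambda>k. - \<i> * (- pi * g k)) y" for y
  proof -
    have "2 * A u y * deriv u y + u y * deriv (A u) y = 2 * (deriv u y * A u y) + deriv (A u) y * u y"
      by simp
    also have "\<dots> = trig_poly K (\<lambda>k. - \<i> * (- pi * g k)) y"
      unfolding deriv_Au unfolding Au deriv_u unfolding u_cos trig_poly_sin_times_cos
      by (simp add: trig_poly_def M_def K_def g_def mode_neg field_simps)
    finally show ?thesis .
  qed
  then have G: "(\<lambda>y. 2 * A u y * deriv u y + u y * deriv (A u) y) = trig_poly K (\<lambda>k. - \<i> * (- pi * g k))"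
    by blast
  have bK: "b k \<noteq> 0" if "k \<in> K" for k
    using b(1)[of k] K(3)[OF that] by simp
  have "2 * f k * b k = k * g k" if "k \<in> K" for k
  proof -
    have "- \<i> * (4 * pi\<^sup>2 * f k) * b k = - 2 * pi * of_int k * (- \<i> * (- pi * g k))"
      by (rule realizes_as_euler_coeff[OF A(1) _ _ K(1,3) real _ F G that])
        (use b(2) bK K M in \<open>auto simp: u_def intro!: trig_poly_in_Chat\<close>)
    then have "2 * pi\<^sup>2 * (2 * f k * b k) = 2 * pi\<^sup>2 * (k * g k)"
      by (simp add: complex_eq_iff power2_eq_square)
    then show ?thesis
      by (simp add: mult_ac)
  qed
  \<comment> \<open>The first two equations give b_2 = 3 b_1 and b_3 = 7 b_1; the third then reads
    21 b_1 = 17 b_1.\<close>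
  from this[of 1] this[of 2] this[of 3]
  have "b 1 = 0"
    by (simp add: K_def f_def g_def)
  with b(1)[of 1] show False
    by simp
qed

theorem corollary3p4:
  shows "\<not> (\<exists>A. regular_inertia_operator A \<and> fourier_type A \<and>
               realizes_as_euler A de_gregorio_vorticity_rhs) \<and>
         \<not> (\<exists>A. regular_inertia_operator A \<and> fourier_type A \<and>
               realizes_as_euler A quasi_geostrophic_vorticity_rhs)"
  using not_realizes_de_gregorio not_realizes_quasi_geostrophic by blast

end
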